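(* Let $n\ge 2$, $m=n-1$, and let $A\in\mathbb Z^{m\times n}$ be a matrix such that (i) the greatest common divisor of all $m\times m$ minors of $A$ is $1$, and (ii) $\{\boldsymbol x\in\mathbb R^n_{\ge 0}:A\boldsymbol x=\boldsymbol 0\}=\{\boldsymbol 0\}$. Let $\boldsymbol z=(z_1,\dots,z_n)\in\mathbb Z^n$ be a primitive integral generator of the kernel of $A$ (i.e. $\gcd(z_1,\dots,z_n)=1$ and $\ker A=\mathbb R\boldsymbol z$). Then $$\mathrm g_1(A)=\frac{z^+z^-}{z^++z^-}-1,$$ where $z^+=\max\{z_i:z_i>0\}$ and $z^-=\max\{|z_i|:z_i<0\}$.
   Context: For $\boldsymbol b\in\mathbb Z^m$ let $P(A,\boldsymbol b)=\{\boldsymbol x\in\mathbb R^n_{\ge 0}:A\boldsymbol x=\boldsymbol b\}$, and let $\mathcal F_1(A)=\{\boldsymbol b\in\mathbb Z^m:\#(P(A,\boldsymbol b)\cap\mathbb Z^n)\ge 1\}$. Let $C\subset\mathbb R^m$ be the convex cone generated by the columns of $A$ and $\boldsymbol v=A\boldsymbol 1$, where $\boldsymbol 1\in\mathbb Z^n$ is the all-ones vector. The diagonal ($1$-)Frobenius number of $A$ is $$\mathrm g_1(A)=\min\{t\in\mathbb R_{\ge 0}:\ \mathrm{int}(t\boldsymbol v+C)\cap\mathbb Z^m\subseteq\mathcal F_1(A)\},$$ where $\mathrm{int}$ denotes the interior.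
   Formalization: The printed equality fails when z⁺=1 or z⁻=1 (e.g. A=(1 1): g₁=0 but the formula is -1/2), so what is proved is g₁(A)=max(0, z⁺z⁻/(z⁺+z⁻)-1), together with the untruncated formula when the minimum is over all real t. *)

theory Defs
  imports "HOL-Analysis.Analysis"
begin

definition real_vec :: "int ^ 'n \<Rightarrow> real ^ 'n" where
  "real_vec x = (\<chi> i. real_of_int (x $ i))"

definition real_mat :: "int ^ 'n ^ 'm \<Rightarrow> real ^ 'n ^ 'm" where
  "real_mat A = map_matrix real_of_int A"

definition polyhedron_P :: "int ^ 'n ^ 'm \<Rightarrow> int ^ 'm \<Rightarrow> (real ^ 'n) set" where
  "polyhedron_P A b = {x. (\<forall>i. 0 \<le> x $ i) \<and> real_mat A *v x = real_vec b}"

definition feasible_1 :: "int ^ 'n ^ 'm \<Rightarrow> (int ^ 'm) set" where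
  "feasible_1 A = {b. polyhedron_P A b \<inter> range real_vec \<noteq> {}}"

definition column_cone :: "int ^ 'n ^ 'm \<Rightarrow> (real ^ 'm) set" where
  "column_cone A = convex_cone hull (columns (real_mat A))"

definition diagonal_vec :: "int ^ 'n ^ 'm \<Rightarrow> real ^ 'm" where
  "diagonal_vec A = real_mat A *v (\<chi> i. 1)"

definition admissible_shifts :: "int ^ 'n ^ 'm \<Rightarrow> real set" where
  "admissible_shifts A =
     {t. interior ((\<lambda>c. t *\<^sub>R diagonal_vec A + c) ` column_cone A) \<inter> range real_vec
           \<subseteq> real_vec ` feasible_1 A}"

definition is_minimum :: "real set \<Rightarrow> real \<Rightarrow> bool" where
  "is_minimum S g \<longleftrightarrow> g \<in> S \<and> (\<forall>t\<in>S. g \<le> t)"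

definition diagonal_frobenius_1 :: "int ^ 'n ^ 'm \<Rightarrow> real" where
  "diagonal_frobenius_1 A = (THE g. is_minimum {t \<in> admissible_shifts A. 0 \<le> t} g)"

text \<open>
  The columns of a maximal square submatrix are selected by an injection of the row index
  type into the column index type. Each choice of columns thus occurs in every order, which
  only changes the sign of the minor and hence leaves the gcd unaffected.
\<close>

definition maximal_minors :: "int ^ 'n ^ 'm \<Rightarrow> int set" where
  "maximal_minors A = {det (\<chi> i j. A $ i $ f j) |f :: 'm \<Rightarrow> 'n. inj f}"

definition primitive_kernel_generator :: "int ^ 'n ^ 'm \<Rightarrow> int ^ 'n \<Rightarrow> bool" where
  "primitive_kernel_generator A z \<longleftrightarrow>
     Gcd (range (\<lambda>i. z $ i)) = 1 \<and>
     {x. real_mat A *v x = 0} = range (\<lambda>s. s *\<^sub>R real_vec z)"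

text \<open>
  Both sets below are nonempty as soon as the kernel of the matrix meets the nonnegative
  orthant only in the origin.
\<close>

definition z_plus :: "int ^ 'n \<Rightarrow> int" where
  "z_plus z = Max {z $ i |i. z $ i > 0}"

definition z_minus :: "int ^ 'n \<Rightarrow> int" where
  "z_minus z = Max {\<bar>z $ i\<bar> |i. z $ i < 0}"

text \<open>
  The number \<open>z\<^sup>+ z\<^sup>- / (z\<^sup>+ + z\<^sup>-) - 1\<close> is negative exactly when \<open>z\<^sup>+ = 1\<close> or \<open>z\<^sup>- = 1\<close>. For
  instance, the matrix \<open>(1 1)\<close> has \<open>z = (1, -1)\<close> and yields \<open>-1/2\<close>. A minimum taken over
  \<open>t \<ge> 0\<close> cannot equal a negative number, so the formula for \<open>diagonal_frobenius_1\<close> is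
  correct only after truncation at \<open>0\<close>; the formula without truncation is the minimum of
  \<open>admissible_shifts\<close>, where \<open>t\<close> ranges over all reals.
\<close>

definition frobenius_formula :: "int ^ 'n \<Rightarrow> real" where
  "frobenius_formula z =
     real_of_int (z_plus z * z_minus z) / real_of_int (z_plus z + z_minus z) - 1"

end

theory Submission
  imports Defs
begin

text \<open>
  Write \<open>P = z\<^sup>+\<close> and \<open>M = z\<^sup>-\<close>. By Cramer's rule the gcd condition makes \<open>A\<close> surjective on integer
  vectors, so every integer \<open>b\<close> is \<open>A y\<close> with \<open>y\<close> integral, and its integral preimages are \<open>y + k z\<close>
  with \<open>k\<close> an integer. Moreover \<open>b\<close> lies in the interior of \<open>t v + C\<close> iff \<open>y + s z > t\<close> componentwise
  for some real \<open>s\<close>.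

  An integer vector is nonnegative iff its entries exceed \<open>-1\<close>. If \<open>y + s z > t\<close> with
  \<open>t + 1 \<ge> P M / (P + M) = \<tau>\<close>, then \<open>y + r z > -1\<close> for all \<open>r\<close> in \<open>[s - \<tau>/P, s + \<tau>/M]\<close>, an interval
  of length 1, which contains an integer. Conversely, if \<open>z\<^sub>i = P\<close> and \<open>z\<^sub>j = -M\<close>, take \<open>y\<^sub>i = -1\<close>,
  \<open>y\<^sub>j = M - 1\<close> and the other entries large: no \<open>y + k z\<close> is nonnegative, while for \<open>s = M / (P + M)\<close>
  the entries \<open>i\<close> and \<open>j\<close> of \<open>y + s z\<close> both equal \<open>\<tau> - 1\<close>.
\<close>

section \<open>Integral linear algebra\<close>

text \<open>Induction on \<open>S\<close> with Bezout's identity. The closure hypotheses make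
  \<open>I\<close> an ideal of the integers; below, \<open>I\<close> is a set of admissible
  multipliers and the point is to get 1 into it.\<close>

lemma Gcd_int_in_ideal:
  fixes S I :: "int set"
  assumes "finite S" "S \<subseteq> I" "0 \<in> I"
    and add: "\<And>a b. a \<in> I \<Longrightarrow> b \<in> I \<Longrightarrow> a + b \<in> I"
    and mult: "\<And>k a. a \<in> I \<Longrightarrow> k * a \<in> I"
  shows "Gcd S \<in> I"
  using assms(1,2)
proof (induction S rule: finite_induct)
  case empty
  then show ?case using \<open>0 \<in> I\<close> by simp
next
  case (insert a S)
  obtain u v where "u * a + v * Gcd S = gcd a (Gcd S)"
    using bezout_int by blast
  moreover have "u * a + v * Gcd S \<in> I"
    using insert by (intro add mult) auto
  ultimately show ?case by simp
qed

lemma real_vec_nth [simp]: "real_vec x $ i = real_of_int (x $ i)"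
  by (simp add: real_vec_def)

lemma real_vec_eq_iff [simp]: "real_vec x = real_vec y \<longleftrightarrow> x = y"
  by (simp add: vec_eq_iff)

lemma Int_range_real_vec_subset_iff:
  "S \<inter> range real_vec \<subseteq> real_vec ` F \<longleftrightarrow> (\<forall>b. real_vec b \<in> S \<longrightarrow> b \<in> F)"
  by auto

lemma real_vec_add: "real_vec (x + y) = real_vec x + real_vec y"
  by (simp add: vec_eq_iff)

lemma real_vec_diff: "real_vec (x - y) = real_vec x - real_vec y"
  by (simp add: vec_eq_iff)

lemma real_vec_smult: "real_vec (c *s x) = real_of_int c *\<^sub>R real_vec x"
  by (simp add: vec_eq_iff)

lemma real_mat_nth [simp]: "real_mat A $ i $ j = real_of_int (A $ i $ j)"
  by (simp add: real_mat_def)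

lemma real_mat_mult_real_vec: "real_mat A *v real_vec x = real_vec (A *v x)"
  by (simp add: vec_eq_iff matrix_vector_mult_def)

lemma det_real_mat: "det (real_mat A) = real_of_int (det A)"
  by (simp add: det_def)

text \<open>Cramer's rule over the reals gives quotients whose numerators are determinants of
  integer matrices; multiplying by \<open>det B\<close> clears the denominator. For a singular
  \<open>B\<close> the zero vector does.\<close>

lemma cramer_int:
  fixes B :: "int ^ 'm ^ 'm" and b :: "int ^ 'm"
  shows "\<exists>w. B *v w = det B *s b"
proof (cases "det B = 0")
  case True
  then show ?thesis
    by (intro exI[of _ 0]) (simp add: vec_eq_iff)
next
  case False
  define w :: "int ^ 'm" where "w = (\<chi> k. det (\<chi> i j. if j = k then b $ i else B $ i $ j))"
  define x :: "real ^ 'm" where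
    "x = (\<chi> k. det (\<chi> i j. if j = k then real_vec b $ i else real_mat B $ i $ j) / det (real_mat B))"
  have "det (real_mat B) \<noteq> 0"
    using False by (simp add: det_real_mat)
  then have x: "real_mat B *v x = real_vec b"
    unfolding x_def by (subst cramer) auto
  have numerator: "(\<chi> i j. if j = k then real_vec b $ i else real_mat B $ i $ j)
      = real_mat (\<chi> i j. if j = k then b $ i else B $ i $ j)" for k
    by (simp add: vec_eq_iff)
  have "real_vec w = real_of_int (det B) *\<^sub>R x"
    using False by (simp add: vec_eq_iff w_def x_def numerator det_real_mat del: real_vec_nth real_mat_nth)
      (simp add: det_real_mat)
  then have "real_mat B *v real_vec w = real_of_int (det B) *\<^sub>R real_vec b"
    using x by (simp add: matrix_vector_mult_scaleR)
  then have "real_vec (B *v w) = real_vec (det B *s b)"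
    by (simp add: real_mat_mult_real_vec real_vec_smult)
  then show ?thesis by auto
qed

text \<open>Solve on the columns selected by \<open>f\<close> and put zeros in all other
  coordinates.\<close>

lemma minor_multiple_in_range:
  fixes A :: "int ^ 'n ^ 'm" and b :: "int ^ 'm" and f :: "'m \<Rightarrow> 'n"
  assumes "inj f"
  shows "\<exists>y. A *v y = det (\<chi> i j. A $ i $ f j) *s b"
proof -
  obtain w where w: "(\<chi> i j. A $ i $ f j) *v w = det (\<chi> i j. A $ i $ f j) *s b"
    using cramer_int by blast
  define y :: "int ^ 'n" where "y = (\<chi> k. if k \<in> range f then w $ inv f k else 0)"
  have "(A *v y) $ i = ((\<chi> i j. A $ i $ f j) *v w) $ i" for i
  proof -
    have "(A *v y) $ i = (\<Sum>k\<in>UNIV. A $ i $ k * y $ k)"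
      by (simp add: matrix_vector_mult_def)
    also have "\<dots> = (\<Sum>k\<in>range f. A $ i $ k * y $ k)"
      by (rule sum.mono_neutral_right) (auto simp: y_def)
    also have "\<dots> = (\<Sum>j\<in>UNIV. A $ i $ f j * w $ j)"
      using assms by (simp add: sum.reindex y_def)
    finally show ?thesis
      by (simp add: matrix_vector_mult_def)
  qed
  then have "A *v y = (\<chi> i j. A $ i $ f j) *v w"
    by (simp add: vec_eq_iff)
  with w show ?thesis by metis
qed

text \<open>The integers \<open>d\<close> for which \<open>d *s b\<close> is attained form an ideal.
  It contains every maximal minor, hence their gcd 1.\<close>

lemma int_matrix_surj:
  fixes A :: "int ^ 'n ^ 'm" and b :: "int ^ 'm"
  assumes "Gcd (maximal_minors A) = 1"
  obtains y where "A *v y = b"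
proof -
  let ?I = "{d. \<exists>y. A *v y = d *s b}"
  have "Gcd (maximal_minors A) \<in> ?I"
  proof (rule Gcd_int_in_ideal)
    show "finite (maximal_minors A)"
      by (simp add: maximal_minors_def)
    show "maximal_minors A \<subseteq> ?I"
      using minor_multiple_in_range by (auto simp: maximal_minors_def)
    show "0 \<in> ?I"
      by (auto intro!: exI[of _ 0] simp: vec_eq_iff)
    show "c + d \<in> ?I" if cd: "c \<in> ?I" "d \<in> ?I" for c d
    proof -
      obtain x y where "A *v x = c *s b" "A *v y = d *s b"
        using cd by blast
      then have "A *v (x + y) = (c + d) *s b"
        by (simp add: matrix_vector_right_distrib vector_sadd_rdistrib)
      then show ?thesis by blast
    qed
    show "k * d \<in> ?I" if d: "d \<in> ?I" for k d
    proof -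
      obtain y where "A *v y = d *s b"
        using d by blast
      moreover have "A *v (k *s y) = k *s (A *v y)"
        by (simp add: vec_eq_iff matrix_vector_mult_def sum_distrib_left mult.left_commute)
      ultimately have "A *v (k *s y) = (k * d) *s b"
        by (simp add: vector_smult_assoc)
      then show ?thesis by blast
    qed
  qed
  then show thesis
    using that assms by auto
qed

text \<open>The image is a subspace and contains each unit vector by the integral case. Surjectivity
  over the reals is what makes the map open.\<close>

lemma real_matrix_surj:
  fixes A :: "int ^ 'n ^ 'm"
  assumes "Gcd (maximal_minors A) = 1"
  shows "surj ((*v) (real_mat A))"
proof -
  let ?R = "range ((*v) (real_mat A))"
  have sub: "subspace ?R"
    by (intro linear_subspace_image matrix_vector_mul_linear subspace_UNIV)
  have ax: "axis i 1 \<in> ?R" for i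
  proof -
    obtain y where "A *v y = axis i 1"
      using int_matrix_surj[OF assms] .
    then have "real_mat A *v real_vec y = axis i 1"
      by (simp add: real_mat_mult_real_vec) (simp add: vec_eq_iff axis_def)
    then show ?thesis by (metis rangeI)
  qed
  have "b \<in> ?R" for b
  proof -
    have "(\<Sum>i\<in>UNIV. b $ i *\<^sub>R axis i 1) \<in> ?R"
      using sub ax by (intro subspace_sum subspace_scale) auto
    then show ?thesis
      using basis_expansion[of b] by (simp add: scalar_mult_eq_scaleR)
  qed
  then show ?thesis by blast
qed

text \<open>The integers \<open>d\<close> with \<open>s * d\<close> integral form an ideal
  containing every entry of \<open>z\<close>, hence 1 by primitivity.\<close>

lemma primitive_scale_integral:
  fixes z x :: "int ^ 'n"
  assumes "Gcd (range (\<lambda>i. z $ i)) = 1" and "real_vec x = s *\<^sub>R real_vec z"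
  obtains k where "s = real_of_int k"
proof -
  let ?I = "{d. s * real_of_int d \<in> \<int>}"
  have "Gcd (range (\<lambda>i. z $ i)) \<in> ?I"
  proof (rule Gcd_int_in_ideal)
    have "s * real_of_int (z $ i) = real_of_int (x $ i)" for i
      using assms(2) by (simp add: vec_eq_iff)
    then show "range (\<lambda>i. z $ i) \<subseteq> ?I"
      by auto
    show "k * d \<in> ?I" if "d \<in> ?I" for k d
      using Ints_mult[of "real_of_int k" "s * real_of_int d"] that
      by (simp add: mult.left_commute)
  qed (auto simp: distrib_left)
  then show thesis
    using that assms(1) by (auto elim: Ints_cases)
qed

section \<open>The column cone\<close>

lemma column_cone_eq:
  fixes A :: "int ^ 'n ^ 'm"
  shows "column_cone A = (*v) (real_mat A) ` {x. \<forall>i. 0 \<le> x $ i}"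
proof
  let ?K = "(*v) (real_mat A) ` {x. \<forall>i. 0 \<le> x $ i}"
  have "convex_cone {x :: real ^ 'n. \<forall>i. 0 \<le> x $ i}"
    by (auto simp: convex_cone_iff)
  then have "convex_cone ?K"
    by (intro convex_cone_linear_image conjI matrix_vector_mul_linear)
  moreover have "columns (real_mat A) \<subseteq> ?K"
  proof
    fix c assume "c \<in> columns (real_mat A)"
    then obtain j where "c = column j (real_mat A)"
      by (auto simp: columns_def)
    then have "c = real_mat A *v axis j 1"
      by (simp add: matrix_vector_mult_basis)
    then show "c \<in> ?K"
      by (auto simp: axis_def)
  qed
  ultimately show "column_cone A \<subseteq> ?K"
    unfolding column_cone_def by (intro hull_minimal)
next
  show "(*v) (real_mat A) ` {x. \<forall>i. 0 \<le> x $ i} \<subseteq> column_cone A"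
  proof clarify
    fix x :: "real ^ 'n" assume x: "\<forall>i. 0 \<le> x $ i"
    have "(\<Sum>i\<in>J. x $ i *\<^sub>R column i (real_mat A)) \<in> column_cone A" if "finite J" for J
      using that
    proof (induction J rule: finite_induct)
      case empty
      then show ?case by (simp add: column_cone_def convex_cone_hull_contains_0)
    next
      case (insert i J)
      have "column i (real_mat A) \<in> column_cone A"
        unfolding column_cone_def by (rule hull_inc) (auto simp: columns_def)
      then show ?case
        using insert x unfolding column_cone_def
        by (simp add: convex_cone_hull_add convex_cone_hull_mul)
    qed
    from this[of UNIV] show "real_mat A *v x \<in> column_cone A"
      by (simp add: matrix_mult_sum scalar_mult_eq_scaleR)
  qed
qed

text \<open>The shifted cone is the image of the orthant \<open>x \<ge> t\<close>, as
  \<open>diagonal_vec A\<close> is the image of the all-ones vector. An interior point remains in it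
  after a small step against that vector; undoing the step upstairs makes all coordinates exceed
  \<open>t\<close>. Conversely, a surjective linear map sends the open orthant to an open
  set.\<close>

lemma interior_shifted_cone:
  fixes A :: "int ^ 'n ^ 'm"
  assumes "surj ((*v) (real_mat A))"
  shows "interior ((\<lambda>c. t *\<^sub>R diagonal_vec A + c) ` column_cone A)
    = (*v) (real_mat A) ` {x. \<forall>i. t < x $ i}" (is "interior ?K = ?O")
proof
  have K: "?K = (*v) (real_mat A) ` {x. \<forall>i. t \<le> x $ i}"
  proof
    show "?K \<subseteq> (*v) (real_mat A) ` {x. \<forall>i. t \<le> x $ i}"
    proof
      fix b assume "b \<in> ?K"
      then obtain x where x: "\<forall>i. 0 \<le> x $ i" "b = t *\<^sub>R diagonal_vec A + real_mat A *v x"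
        by (auto simp: column_cone_eq)
      have "b = real_mat A *v (t *\<^sub>R (\<chi> i. 1) + x)"
        by (simp add: x(2) diagonal_vec_def matrix_vector_right_distrib matrix_vector_mult_scaleR)
      then show "b \<in> (*v) (real_mat A) ` {x. \<forall>i. t \<le> x $ i}"
        using x(1) by auto
    qed
    show "(*v) (real_mat A) ` {x. \<forall>i. t \<le> x $ i} \<subseteq> ?K"
    proof clarify
      fix x :: "real ^ 'n" assume x: "\<forall>i. t \<le> x $ i"
      have "real_mat A *v x = t *\<^sub>R diagonal_vec A + real_mat A *v (x - t *\<^sub>R (\<chi> i. 1))"
        by (simp add: diagonal_vec_def matrix_vector_mult_diff_distrib matrix_vector_mult_scaleR)
      moreover have "real_mat A *v (x - t *\<^sub>R (\<chi> i. 1)) \<in> column_cone A"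
        using x by (auto simp: column_cone_eq)
      ultimately show "real_mat A *v x \<in> ?K"
        by (rule image_eqI)
    qed
  qed
  show "interior ?K \<subseteq> ?O"
  proof
    fix b assume "b \<in> interior ?K"
    then obtain e where e: "e > 0" "cball b e \<subseteq> ?K"
      by (auto simp: mem_interior_cball)
    define v where "v = diagonal_vec A"
    \<comment> \<open>The summand 1 keeps the denominator positive even if \<open>v\<close> is
      zero.\<close>
    define d where "d = e / (norm v + 1)"
    have d: "d > 0"
      using e by (simp add: d_def add_nonneg_pos)
    have "d * norm v \<le> d * (norm v + 1)"
      using d by simp
    also have "\<dots> = e"
      by (simp add: d_def add_nonneg_eq_0_iff)
    finally have "b - d *\<^sub>R v \<in> cball b e"
      using d by (simp add: dist_norm)
    then have "b - d *\<^sub>R v \<in> (*v) (real_mat A) ` {x. \<forall>i. t \<le> x $ i}"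
      using e(2) unfolding K by (rule subsetD[rotated])
    then obtain x where x: "\<forall>i. t \<le> x $ i" "b - d *\<^sub>R v = real_mat A *v x"
      by auto
    have "b = real_mat A *v x + d *\<^sub>R v"
      by (simp flip: x(2))
    then have "b = real_mat A *v (x + d *\<^sub>R (\<chi> i. 1))"
      by (simp add: v_def diagonal_vec_def matrix_vector_right_distrib matrix_vector_mult_scaleR)
    moreover have "\<forall>i. t < (x + d *\<^sub>R (\<chi> i. 1)) $ i"
      using x(1) d by (simp add: add.commute add_strict_increasing)
    ultimately show "b \<in> ?O" by blast
  qed
  have "{x :: real ^ 'n. \<forall>i. t < x $ i} = (\<Inter>i. {x. t < x $ i})"
    by auto
  then have "open {x :: real ^ 'n. \<forall>i. t < x $ i}"
    by (simp add: open_INT open_halfspace_component_gt_cart)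
  then have "open ?O"
    by (intro open_surjective_linear_image assms matrix_vector_mul_linear)
  moreover have "?O \<subseteq> ?K"
    unfolding K by (intro image_mono Collect_mono) (simp add: less_imp_le)
  ultimately show "?O \<subseteq> interior ?K"
    by (rule interior_maximal[rotated])
qed

section \<open>Feasibility in terms of a kernel generator\<close>

lemma feasible_1_iff:
  "b \<in> feasible_1 A \<longleftrightarrow> (\<exists>x. (\<forall>i. 0 \<le> x $ i) \<and> A *v x = b)"
proof -
  have "b \<in> feasible_1 A \<longleftrightarrow> (\<exists>x. real_vec x \<in> polyhedron_P A b)"
    by (auto simp: feasible_1_def)
  then show ?thesis
    by (simp add: polyhedron_P_def real_mat_mult_real_vec)
qed

lemma kernel_generator_shift:
  assumes "primitive_kernel_generator A z"
  shows "real_mat A *v (x + s *\<^sub>R real_vec z) = real_mat A *v x"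
proof -
  have "s *\<^sub>R real_vec z \<in> {x. real_mat A *v x = 0}"
    using assms unfolding primitive_kernel_generator_def by blast
  then show ?thesis
    by (simp add: matrix_vector_right_distrib)
qed

lemma kernel_generator_fibre:
  assumes "primitive_kernel_generator A z" and "real_mat A *v x = real_mat A *v y"
  obtains s where "x = y + s *\<^sub>R real_vec z"
proof -
  have "x - y \<in> {x. real_mat A *v x = 0}"
    using assms(2) by (simp add: matrix_vector_mult_diff_distrib)
  then obtain s where "x - y = s *\<^sub>R real_vec z"
    using assms(1) unfolding primitive_kernel_generator_def by blast
  then show thesis
    using that by (metis add.commute diff_add_cancel)
qed

text \<open>Two integral points of one fibre differ by a real multiple of \<open>z\<close>, and
  primitivity makes the factor an integer.\<close>

lemma feasible_1_shift_iff:
  assumes "primitive_kernel_generator A z"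
  shows "A *v y \<in> feasible_1 A \<longleftrightarrow> (\<exists>k. \<forall>i. 0 \<le> y $ i + k * z $ i)"
proof
  assume "A *v y \<in> feasible_1 A"
  then obtain x where x: "\<forall>i. 0 \<le> x $ i" "A *v x = A *v y"
    by (auto simp: feasible_1_iff)
  then have "real_mat A *v real_vec x = real_mat A *v real_vec y"
    by (simp add: real_mat_mult_real_vec)
  then obtain s where s: "real_vec x = real_vec y + s *\<^sub>R real_vec z"
    using kernel_generator_fibre[OF assms] by blast
  then have "real_vec (x - y) = s *\<^sub>R real_vec z"
    by (simp add: real_vec_diff)
  then obtain k where k: "s = real_of_int k"
    using primitive_scale_integral assms unfolding primitive_kernel_generator_def by blast
  have "real_vec x = real_vec (y + k *s z)"
    using s k by (simp add: real_vec_add real_vec_smult)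
  then have "x = y + k *s z"
    by simp
  then show "\<exists>k. \<forall>i. 0 \<le> y $ i + k * z $ i"
    using x(1) by auto
next
  assume "\<exists>k. \<forall>i. 0 \<le> y $ i + k * z $ i"
  then obtain k where k: "\<forall>i. 0 \<le> y $ i + k * z $ i" ..
  have "real_vec (A *v (y + k *s z)) = real_vec (A *v y)"
    using kernel_generator_shift[OF assms]
    by (simp add: real_mat_mult_real_vec[symmetric] real_vec_add real_vec_smult)
  then have "A *v (y + k *s z) = A *v y"
    by simp
  then show "A *v y \<in> feasible_1 A"
    using k unfolding feasible_1_iff by (intro exI[of _ "y + k *s z"]) simp
qed

lemma admissible_shifts_iff:
  fixes A :: "int ^ 'n ^ 'm"
  assumes gcd: "Gcd (maximal_minors A) = 1" and z: "primitive_kernel_generator A z"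
  shows "t \<in> admissible_shifts A \<longleftrightarrow>
    (\<forall>y s. (\<forall>i. t < real_of_int (y $ i) + s * real_of_int (z $ i)) \<longrightarrow>
       (\<exists>k. \<forall>i. 0 \<le> y $ i + k * z $ i))" (is "_ \<longleftrightarrow> ?R")
proof -
  have interior_iff: "real_vec (A *v y) \<in> (*v) (real_mat A) ` {x. \<forall>i. t < x $ i} \<longleftrightarrow>
      (\<exists>s. \<forall>i. t < real_of_int (y $ i) + s * real_of_int (z $ i))" for y
  proof
    assume "real_vec (A *v y) \<in> (*v) (real_mat A) ` {x. \<forall>i. t < x $ i}"
    then obtain x where x: "\<forall>i. t < x $ i" "real_mat A *v x = real_mat A *v real_vec y"
      by (auto simp: real_mat_mult_real_vec)
    then obtain s where "x = real_vec y + s *\<^sub>R real_vec z"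
      using kernel_generator_fibre[OF z] by blast
    with x(1) show "\<exists>s. \<forall>i. t < real_of_int (y $ i) + s * real_of_int (z $ i)"
      by auto
  next
    assume "\<exists>s. \<forall>i. t < real_of_int (y $ i) + s * real_of_int (z $ i)"
    then obtain s where s: "\<forall>i. t < real_of_int (y $ i) + s * real_of_int (z $ i)" ..
    have "real_vec (A *v y) = real_mat A *v (real_vec y + s *\<^sub>R real_vec z)"
      by (simp add: kernel_generator_shift[OF z] real_mat_mult_real_vec)
    then show "real_vec (A *v y) \<in> (*v) (real_mat A) ` {x. \<forall>i. t < x $ i}"
      using s by auto
  qed
  have "t \<in> admissible_shifts A \<longleftrightarrow>
      (\<forall>b. real_vec b \<in> (*v) (real_mat A) ` {x. \<forall>i. t < x $ i} \<longrightarrow> b \<in> feasible_1 A)"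
    unfolding admissible_shifts_def interior_shifted_cone[OF real_matrix_surj[OF gcd]]
    by (simp add: Int_range_real_vec_subset_iff)
  \<comment> \<open>By integral surjectivity every \<open>b\<close> is some \<open>A *v y\<close>,
    so \<open>y\<close> can be quantified instead.\<close>
  also have "\<dots> \<longleftrightarrow> (\<forall>y. real_vec (A *v y) \<in> (*v) (real_mat A) ` {x. \<forall>i. t < x $ i} \<longrightarrow>
      A *v y \<in> feasible_1 A)"
    (is "(\<forall>b. ?Q b) \<longleftrightarrow> (\<forall>y. ?Q (A *v y))")
  proof (intro iffI allI)
    show "?Q b" if "\<forall>y. ?Q (A *v y)" for b
    proof -
      obtain y where "A *v y = b"
        using int_matrix_surj[OF gcd] .
      with spec[OF that, of y] show ?thesis by (simp only:)
    qed
  qed (rule spec)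
  also have "\<dots> \<longleftrightarrow> ?R"
    unfolding interior_iff feasible_1_shift_iff[OF z] by blast
  finally show ?thesis .
qed

section \<open>The critical shift\<close>

lemma z_plus_attained:
  assumes "\<exists>i. 0 < z $ i"
  shows "\<exists>i. z $ i = z_plus z" and "0 < z_plus z" and "z $ l \<le> z_plus z"
proof -
  let ?S = "{z $ i |i. z $ i > 0}"
  have S: "finite ?S" "?S \<noteq> {}"
    using assms by auto
  then have "Max ?S \<in> ?S"
    by (rule Max_in)
  then show "\<exists>i. z $ i = z_plus z" and pos: "0 < z_plus z"
    unfolding z_plus_def by auto
  show "z $ l \<le> z_plus z"
  proof (cases "z $ l > 0")
    case True
    then show ?thesis
      unfolding z_plus_def using S by (intro Max_ge) auto
  qed (use pos in linarith)
qed

text \<open>Lets the facts about \<open>z_plus\<close> serve for \<open>z_minus\<close> as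
  well.\<close>

lemma z_minus_eq_z_plus_uminus: "z_minus z = z_plus (- z)"
proof -
  have "{\<bar>z $ i\<bar> |i. z $ i < 0} = {(- z) $ i |i. (- z) $ i > 0}"
    by force
  then show ?thesis
    by (simp only: z_minus_def z_plus_def)
qed

text \<open>Otherwise \<open>z\<close> or its negative would be a nonzero kernel vector in the
  nonnegative orthant.\<close>

lemma kernel_generator_mixed_signs:
  fixes A :: "int ^ 'n ^ 'm"
  assumes cone: "{x :: real ^ 'n. (\<forall>i. 0 \<le> x $ i) \<and> real_mat A *v x = 0} = {0}"
    and z: "primitive_kernel_generator A z"
  shows "\<exists>i. 0 < z $ i" and "\<exists>i. z $ i < 0"
proof -
  have nz: "z \<noteq> 0"
    using z by (auto simp: primitive_kernel_generator_def)
  have kernel: "real_mat A *v (s *\<^sub>R real_vec z) = 0" for s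
    using kernel_generator_shift[OF z, of 0 s] by simp
  have nonneg: "s = 0" if "\<forall>i. 0 \<le> s * real_of_int (z $ i)" for s
  proof -
    have "s *\<^sub>R real_vec z \<in> {x. (\<forall>i. 0 \<le> x $ i) \<and> real_mat A *v x = 0}"
      using that kernel by simp
    then have "s *\<^sub>R real_vec z = 0"
      using cone by blast
    then show "s = 0"
      using nz by (auto simp: vec_eq_iff)
  qed
  show "\<exists>i. 0 < z $ i"
    using nonneg[of "-1"] by (auto simp: not_less[symmetric])
  show "\<exists>i. z $ i < 0"
    using nonneg[of 1] by (auto simp: not_less[symmetric])
qed

lemma frobenius_formula_le_imp_lattice_point:
  fixes z y :: "int ^ 'n"
  assumes pos: "\<exists>i. 0 < z $ i" and neg: "\<exists>i. z $ i < 0"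
    and t: "frobenius_formula z \<le> t"
    and s: "\<And>i. t < real_of_int (y $ i) + s * real_of_int (z $ i)"
  shows "\<exists>k. \<forall>i. 0 \<le> y $ i + k * z $ i"
proof -
  define P M where "P = real_of_int (z_plus z)" and "M = real_of_int (z_minus z)"
  define \<tau> where "\<tau> = P * M / (P + M)"
  have neg': "\<exists>i. 0 < (- z) $ i"
    using neg by simp
  have PM: "0 < P" "0 < M"
    using z_plus_attained(2)[OF pos] z_plus_attained(2)[OF neg']
    by (simp_all add: P_def M_def z_minus_eq_z_plus_uminus)
  have zP: "real_of_int (z $ i) \<le> P" for i
    using z_plus_attained(3)[OF pos] by (simp add: P_def)
  have zM: "- real_of_int (z $ i) \<le> M" for i
    using z_plus_attained(3)[OF neg', of i] by (simp add: M_def z_minus_eq_z_plus_uminus flip: of_int_minus)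
  have \<tau>: "\<tau> > 0" "\<tau> \<le> t + 1"
    using PM t by (simp_all add: \<tau>_def frobenius_formula_def P_def M_def)
  have "\<tau> / P = M / (P + M)" "\<tau> / M = P / (P + M)"
    using PM by (simp_all add: \<tau>_def)
  then have "\<tau> / P + \<tau> / M = 1"
    using PM by (simp flip: add_divide_distrib)
  \<comment> \<open>The largest integer up to the right end of the interval; as the length is 1, it
    does not fall below the left end.\<close>
  define k where "k = \<lfloor>s + \<tau> / M\<rfloor>"
  have k: "real_of_int k \<le> s + \<tau> / M" "s - \<tau> / P \<le> real_of_int k"
    using \<open>\<tau> / P + \<tau> / M = 1\<close> by (simp_all add: k_def) linarith
  have "0 \<le> y $ i + k * z $ i" for i
  proof -
    \<comment> \<open>Moving from \<open>s\<close> to \<open>k\<close> lowers no entry by more than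
      \<tau>: to the right, entries fall at rate at most \<open>M\<close>, to the left at rate at
      most \<open>P\<close>.\<close>
    have "- \<tau> \<le> (real_of_int k - s) * real_of_int (z $ i)"
    proof (cases "real_of_int k \<ge> s")
      case True
      have "(real_of_int k - s) * (- real_of_int (z $ i)) \<le> (real_of_int k - s) * M"
        using True zM by (intro mult_left_mono) auto
      also have "\<dots> \<le> \<tau> / M * M"
        using k PM by (intro mult_right_mono) auto
      finally show ?thesis
        using PM by simp
    next
      case False
      have "(s - real_of_int k) * real_of_int (z $ i) \<le> (s - real_of_int k) * P"
        using False zP by (intro mult_left_mono) auto
      also have "\<dots> \<le> \<tau> / P * P"
        using k PM by (intro mult_right_mono) auto
      finally show ?thesis
        using PM by (simp add: algebra_simps)
    qed
    \<comment> \<open>The bound is strict because \<open>s\<close> gives values strictly above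
      \<open>t\<close>, and an integer above -1 is nonnegative.\<close>
    then have "- 1 < real_of_int (y $ i) + real_of_int k * real_of_int (z $ i)"
      using s[of i] \<tau> by (simp add: algebra_simps)
    then have "real_of_int (- 1) < real_of_int (y $ i + k * z $ i)"
      by simp
    then show ?thesis
      unfolding of_int_less_iff by linarith
  qed
  then show ?thesis by blast
qed

lemma less_frobenius_formula_imp_no_lattice_point:
  fixes z :: "int ^ 'n"
  assumes pos: "\<exists>i. 0 < z $ i" and neg: "\<exists>i. z $ i < 0"
    and t: "t < frobenius_formula z"
  shows "\<exists>y s. (\<forall>i. t < real_of_int (y $ i) + s * real_of_int (z $ i)) \<and>
    \<not> (\<exists>k. \<forall>i. 0 \<le> y $ i + k * z $ i)"
proof -
  define P M where "P = z_plus z" and "M = z_minus z"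
  have neg': "\<exists>i. 0 < (- z) $ i"
    using neg by simp
  have PM: "0 < P" "0 < M"
    using z_plus_attained(2)[OF pos] z_plus_attained(2)[OF neg']
    by (simp_all add: P_def M_def z_minus_eq_z_plus_uminus)
  obtain i where i: "z $ i = P"
    using z_plus_attained(1)[OF pos] P_def by blast
  obtain j where j: "z $ j = - M"
    using z_plus_attained(1)[OF neg'] by (metis M_def minus_minus vector_uminus_component z_minus_eq_z_plus_uminus)
  have "i \<noteq> j"
    using i j PM by auto
  \<comment> \<open>The solution of \<open>- 1 + s * P = (M - 1) - s * M\<close>, which balances the
    two critical entries.\<close>
  define s where "s = real_of_int M / real_of_int (P + M)"
  \<comment> \<open>For the remaining entries, floor plus one is the least integer choice that puts
    the value at \<open>s\<close> strictly above \<open>t\<close>.\<close>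
  define y :: "int ^ 'n" where "y = (\<chi> l. if l = i then - 1 else if l = j then M - 1
    else \<lfloor>t - s * real_of_int (z $ l)\<rfloor> + 1)"
  have f: "frobenius_formula z = real_of_int P * s - 1"
    by (simp add: frobenius_formula_def P_def M_def s_def)
  have Ms: "real_of_int M - s * real_of_int M = real_of_int P * s"
    using PM by (simp add: s_def field_simps)
  have "t < real_of_int (y $ l) + s * real_of_int (z $ l)" for l
  proof -
    consider "l = i" | "l = j" | "l \<noteq> i" "l \<noteq> j" by blast
    then show ?thesis
    proof cases
      case 1
      then show ?thesis using t f i by (simp add: y_def mult.commute)
    next
      case 2
      then show ?thesis using t f j Ms \<open>i \<noteq> j\<close> by (simp add: y_def)
    next
      case 3
      then show ?thesis by (simp add: y_def) linarith
    qed
  qed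
  moreover have "\<not> (\<forall>l. 0 \<le> y $ l + k * z $ l)" for k
  proof
    assume nonneg: "\<forall>l. 0 \<le> y $ l + k * z $ l"
    \<comment> \<open>Entry \<open>i\<close> starts at -1 and forces \<open>k\<close> to be at least
      1, whereas entry \<open>j\<close> starts at \<open>M - 1\<close> and cannot afford even one
      subtraction of \<open>M\<close>.\<close>
    have "0 < k * P"
      using nonneg[rule_format, of i] i by (simp add: y_def)
    then have "1 \<le> k"
      using PM by (simp add: zero_less_mult_iff)
    then have "M \<le> k * M"
      using PM by simp
    moreover have "k * M \<le> M - 1"
      using nonneg[rule_format, of j] j \<open>i \<noteq> j\<close> by (simp add: y_def)
    ultimately show False by simp
  qed
  ultimately show ?thesis by blast
qed

lemma is_minimum_unique: "is_minimum S g \<Longrightarrow> is_minimum S h \<Longrightarrow> g = h"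
  by (meson antisym is_minimum_def)

theorem theorem1p4:
  fixes A :: "int ^ 'n ^ 'm" and z :: "int ^ 'n"
  assumes "CARD('n) \<ge> 2" and "CARD('m) = CARD('n) - 1"
    and "Gcd (maximal_minors A) = 1"
    and "{x :: real ^ 'n. (\<forall>i. 0 \<le> x $ i) \<and> real_mat A *v x = 0} = {0}"
    and "primitive_kernel_generator A z"
  shows "is_minimum {t \<in> admissible_shifts A. 0 \<le> t} (diagonal_frobenius_1 A)
    \<and> diagonal_frobenius_1 A = max 0 (frobenius_formula z)
    \<and> is_minimum (admissible_shifts A) (frobenius_formula z)"
proof -
  note signs = kernel_generator_mixed_signs[OF assms(4,5)]
  have "t \<in> admissible_shifts A \<longleftrightarrow> frobenius_formula z \<le> t" for t
    unfolding admissible_shifts_iff[OF assms(3,5)]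
    using frobenius_formula_le_imp_lattice_point[OF signs, of t]
      less_frobenius_formula_imp_no_lattice_point[OF signs, of t]
    by (meson not_le)
  then have adm: "admissible_shifts A = {frobenius_formula z..}"
    by auto
  \<comment> \<open>The admissible shifts form a closed half-line, so restricting to
    \<open>0 \<le> t\<close> moves its least element to the larger of 0 and the formula.\<close>
  have min: "is_minimum {t \<in> admissible_shifts A. 0 \<le> t} (max 0 (frobenius_formula z))"
    by (auto simp: adm is_minimum_def)
  then have "diagonal_frobenius_1 A = max 0 (frobenius_formula z)"
    unfolding diagonal_frobenius_1_def by (intro the_equality is_minimum_unique)
  with min show ?thesis
    by (simp add: adm is_minimum_def)
qed

end
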